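(* Let $t\in\mathbb{R}\setminus\mathbb{Z}_{\ge0}$ and $f\in\mathcal{U}(H\mathbb{R})$. For $m\ge1$ let $f^{\boxplus^H_t m}$ denote the $m$-fold $\boxplus^H_t$-convolution power of $f$. (i) If $\kappa_1^t(f)=\lambda$, then $D_{1/m}\bigl(f^{\boxplus^H_t m}\bigr)\longrightarrow\mathsf{B}_\lambda^{(t)}$. (ii) If $\kappa_1^t(f)=0$ and $\kappa_2^t(f)=1$, then $D_{1/\sqrt m}\bigl(f^{\boxplus^H_t m}\bigr)\longrightarrow\mathsf{H}^{(t)}$. Both limits are coefficientwise as $m\to\infty$.
   Context: $\mathbb{N}=\{0,1,2,\dots\}$. $H\mathbb{R}$ is the set of all maps $f:\mathbb{N}\to\mathbb{R}$. $(a)_{\underline{0}}=1$, $(a)_{\underline{n}}=a(a-1)\cdots(a-n+1)$ for $n\ge1$. The convolution is $(f\boxplus^H_tg)(n)=\sum_{i+j=n}\frac{(t)_{\underline{n}}}{(t)_{\underline{i}}(t)_{\underline{j}}}f(i)g(j)$, $n\in\mathbb{N}$. $\mathcal{U}(H\mathbb{R})=\{f\in H\mathbb{R}:f(0)=1\}$. Dilation: $(D_rf)(n)=r^nf(n)$ for $r\in\mathbb{R}$. Coefficientwise convergence $f_m\to f$ means $f_m(n)\to f(n)$ for each fixed $n\in\mathbb{N}$. The cumulants $\kappa_n^t(f)$ of $f\in\mathcal{U}(H\mathbb{R})$ are defined by the formal power series identity $$\sum_{n\ge1}\kappa_n^t(f)z^n=-\frac{z}{t}\frac{d}{dz}\log\left(1+\sum_{n\ge1}\frac{t^n}{(t)_{\underline{n}}}f(n)z^n\right).$$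 Binomial family: $\mathsf{B}_\lambda^{(t)}(n)=(-1)^n\frac{(t)_{\underline{n}}}{n!}\lambda^n$ for $\lambda\in\mathbb{R}$. Hermite series: $\mathsf{H}^{(t)}(2k)=(-1)^k\frac{(t)_{\underline{2k}}}{t^k(2k)!!}$ and $\mathsf{H}^{(t)}(2k+1)=0$, where $(2k)!!=2^kk!$. *)

theory Defs
  imports "HOL-Computational_Algebra.Formal_Power_Series"
begin

definition falling_fact :: "real \<Rightarrow> nat \<Rightarrow> real" where
  "falling_fact a n = (\<Prod>i<n. a - real i)"

definition hconv :: "real \<Rightarrow> (nat \<Rightarrow> real) \<Rightarrow> (nat \<Rightarrow> real) \<Rightarrow> nat \<Rightarrow> real" where
  "hconv t f g n =
     (\<Sum>i\<le>n. falling_fact t n / (falling_fact t i * falling_fact t (n - i)) * f i * g (n - i))"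

definition hunit :: "nat \<Rightarrow> real" where
  "hunit n = (if n = 0 then 1 else 0)"

primrec hconv_power :: "real \<Rightarrow> (nat \<Rightarrow> real) \<Rightarrow> nat \<Rightarrow> nat \<Rightarrow> real" where
  "hconv_power t f 0 = hunit"
| "hconv_power t f (Suc m) = hconv t (hconv_power t f m) f"

definition dilation :: "real \<Rightarrow> (nat \<Rightarrow> real) \<Rightarrow> nat \<Rightarrow> real" where
  "dilation r f n = r ^ n * f n"

definition UH :: "(nat \<Rightarrow> real) set" where
  "UH = {f. f 0 = 1}"

text \<open>Since \<open>fps_ln 1\<close> is the series of \<open>log (1 + z)\<close>, the composition below is
  \<open>log (1 + F)\<close> for the series \<open>F\<close> without constant term given as its second argument.\<close>

definition cumulant_series :: "real \<Rightarrow> (nat \<Rightarrow> real) \<Rightarrow> real fps" where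
  "cumulant_series t f =
     - (fps_const (1 / t) * fps_X *
        fps_deriv (fps_compose (fps_ln 1)
          (Abs_fps (\<lambda>n. if n = 0 then 0 else t ^ n / falling_fact t n * f n))))"

definition cumulant :: "real \<Rightarrow> (nat \<Rightarrow> real) \<Rightarrow> nat \<Rightarrow> real" where
  "cumulant t f n = fps_nth (cumulant_series t f) n"

definition binomial_series :: "real \<Rightarrow> real \<Rightarrow> nat \<Rightarrow> real" where
  "binomial_series t l n = (-1) ^ n * (falling_fact t n / fact n) * l ^ n"

text \<open>For even \<open>n = 2 k\<close> the double factorial of \<open>n\<close> is \<open>2 ^ k * k!\<close>.\<close>

definition hermite_series :: "real \<Rightarrow> nat \<Rightarrow> real" where
  "hermite_series t n =
     (if even n
      then (let k = n div 2 in (-1) ^ k * (falling_fact t n / (t ^ k * (2 ^ k * fact k))))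
      else 0)"

text \<open>For \<open>t\<close> outside the natural numbers \<open>hunit\<close> is neutral, so that the first convolution
  power of \<open>f\<close> is \<open>f\<close> itself.\<close>

lemma falling_fact_nonzero: "t \<notin> \<nat> \<Longrightarrow> falling_fact t n \<noteq> 0"
  by (auto simp: falling_fact_def)

lemma hconv_hunit_left:
  assumes "t \<notin> \<nat>"
  shows "hconv t hunit f = f"
proof
  fix n
  have "hconv t hunit f n = (\<Sum>i\<le>n. if i = 0 then f n else 0)"
    unfolding hconv_def
    by (intro sum.cong refl)
      (auto simp: hunit_def falling_fact_nonzero[OF assms], simp add: falling_fact_def)
  then show "hconv t hunit f n = f n" by simp
qed

lemma hconv_power_1: "t \<notin> \<nat> \<Longrightarrow> hconv_power t f (Suc 0) = f"
  by (simp add: hconv_hunit_left)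

lemma cumulant_1: "t \<noteq> 0 \<Longrightarrow> cumulant t f 1 = - f 1 / t"
  by (simp add: cumulant_def cumulant_series_def mult.assoc fps_compose_nth fps_ln_nth
      falling_fact_def)

end

theory Submission
  imports Defs
begin

text \<open>
  The map sending \<open>f\<close> to \<open>F(z) = \<Sum>n. f n / falling_fact t n * z ^ n\<close> turns \<open>hconv t\<close> into the product
  of power series and commutes with dilations, so both limits are instances of
  \<open>F (r\<^sub>m z) ^ m \<rightarrow> exp (a z ^ d)\<close> for \<open>F(z) = 1 + a z ^ d + \<dots>\<close> and \<open>m r\<^sub>m ^ d \<rightarrow> 1\<close>, with \<open>d = 1\<close> and
  \<open>d = 2\<close>. The coefficients of \<open>F ^ m\<close> satisfy the recursion given by the differential equation
  \<open>F (F ^ m)' = m F' F ^ m\<close>, whose rescaling tends termwise to the recursion for \<open>exp (a z ^ d)\<close>.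
\<close>

text \<open>Dividing by \<open>falling_fact t k\<close> absorbs the weights of \<open>hconv\<close>,
  leaving the Cauchy product; \<open>t \<notin> \<nat>\<close> keeps all these divisors
  nonzero.\<close>

lemma hconv_power_eq_fps_power:
  assumes "t \<notin> \<nat>"
  shows "hconv_power t f m n =
    falling_fact t n * fps_nth (Abs_fps (\<lambda>k. f k / falling_fact t k) ^ m) n"
proof (induction m arbitrary: n)
  case 0
  then show ?case by (simp add: hunit_def falling_fact_def)
next
  case (Suc m)
  show ?case
    unfolding hconv_power.simps power_Suc2 fps_mult_nth sum_distrib_left hconv_def atLeast0AtMost
    by (intro sum.cong refl) (simp add: Suc.IH falling_fact_nonzero[OF assms])
qed

lemma fps_nth_X_mult_deriv: "fps_nth (fps_X * fps_deriv F) n = of_nat n * fps_nth F n"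
  by (cases n) auto

lemma fps_power_nth_rec:
  fixes F :: "'a::comm_ring_1 fps"
  assumes "fps_nth F 0 = 1"
  shows "of_nat n * fps_nth (F ^ m) n =
    (\<Sum>i=1..n. (of_nat m * of_nat i - of_nat (n - i)) * fps_nth F i * fps_nth (F ^ m) (n - i))"
proof -
  let ?P = "F ^ m"
  have "F * fps_deriv ?P = of_nat m * fps_deriv F * ?P"
    by (induction m) (simp_all add: algebra_simps)
  \<comment> \<open>The factor \<open>fps_X\<close> turns the derivative into the Euler operator,
    which scales the coefficient at \<open>n\<close> by \<open>n\<close> without shifting the
    index.\<close>
  then have "F * (fps_X * fps_deriv ?P) = of_nat m * ((fps_X * fps_deriv F) * ?P)"
    by (metis mult.assoc mult.left_commute)
  then have "fps_nth (F * (fps_X * fps_deriv ?P)) n =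
      of_nat m * fps_nth ((fps_X * fps_deriv F) * ?P) n"
    by (simp add: fps_of_nat [symmetric] fps_mult_left_const_nth)
  then have "(\<Sum>i=0..n. fps_nth F i * (of_nat (n - i) * fps_nth ?P (n - i))) =
      of_nat m * (\<Sum>i=0..n. of_nat i * fps_nth F i * fps_nth ?P (n - i))"
    unfolding fps_mult_nth[of F] fps_mult_nth[of "fps_X * fps_deriv F"] fps_nth_X_mult_deriv .
  \<comment> \<open>Since \<open>F\<close> has constant term 1, the summand \<open>i = 0\<close> on
    the left is the isolated term; on the right that summand vanishes.\<close>
  then show ?thesis
    using assms
    by (simp add: sum.atLeast_Suc_atMost algebra_simps sum_subtractf sum.distrib
        sum_distrib_left eq_diff_eq)
qed

text \<open>Strong induction on \<open>n\<close>: dividing the recursion by \<open>n\<close>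
  expresses each scaled coefficient through earlier ones, with finitely many factors that converge
  separately.\<close>

lemma tendsto_scaled_fps_power_nth:
  fixes F :: "real fps" and r :: "nat \<Rightarrow> real"
  assumes F0: "fps_nth F 0 = 1" and gap: "\<And>i. 0 < i \<Longrightarrow> i < d \<Longrightarrow> fps_nth F i = 0"
    and "d > 0" and r: "r \<longlonglongrightarrow> 0" and mr: "(\<lambda>m. real m * r m ^ d) \<longlonglongrightarrow> 1"
  shows "(\<lambda>m. r m ^ n * fps_nth (F ^ m) n) \<longlonglongrightarrow>
    (if d dvd n then fps_nth F d ^ (n div d) / fact (n div d) else 0)"
proof (induction n rule: less_induct)
  case (less n)
  define Q where "Q n = (if d dvd n then fps_nth F d ^ (n div d) / fact (n div d) else 0)" for n
  show ?case
  proof (cases "n = 0")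
    case True
    then show ?thesis using F0 by (simp add: fps_nth_power_0)
  next
    case False
    \<comment> \<open>Only \<open>i = d\<close> survives: smaller \<open>i\<close> are removed by
      the gap, larger ones carry an extra factor \<open>r m ^ (i - d)\<close> tending to 0, and the
      part without \<open>real m\<close> always tends to 0.\<close>
    have coeff: "(\<lambda>m. (real m * real i - real (n - i)) * fps_nth F i * r m ^ i)
        \<longlonglongrightarrow> (if i = d then real d * fps_nth F d else 0)" if "i \<ge> 1" for i
    proof (cases "i < d")
      case True
      then show ?thesis using gap that by simp
    next
      case False
      then have i: "i = d + (i - d)" by simp
      \<comment> \<open>The factor \<open>0 ^ (i - d)\<close> is 1 for \<open>i = d\<close> and 0
        for \<open>i > d\<close>, so one limit covers both cases.\<close>
      have "(\<lambda>m. (real m * r m ^ d * r m ^ (i - d) * real i - real (n - i) * r m ^ i) * fps_nth F i)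
          \<longlonglongrightarrow> (1 * 0 ^ (i - d) * real i - real (n - i) * 0 ^ i) * fps_nth F i"
        by (intro tendsto_intros mr r)
      moreover have "real m * r m ^ d * r m ^ (i - d) = real m * r m ^ i" for m
        using arg_cong[OF i, of "power (r m)"] by (simp add: power_add)
      ultimately have "(\<lambda>m. (real m * r m ^ i * real i - real (n - i) * r m ^ i) * fps_nth F i)
          \<longlonglongrightarrow> (1 * 0 ^ (i - d) * real i - real (n - i) * 0 ^ i) * fps_nth F i"
        by (simp only:)
      then show ?thesis
        using that False by (auto simp: algebra_simps power_0_left)
    qed
    have "(\<lambda>m. (\<Sum>i=1..n. ((real m * real i - real (n - i)) * fps_nth F i * r m ^ i) *
            (r m ^ (n - i) * fps_nth (F ^ m) (n - i))) / real n)
        \<longlonglongrightarrow> (\<Sum>i=1..n. (if i = d then real d * fps_nth F d else 0) * Q (n - i)) / real n"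
      using less False unfolding Q_def by (intro tendsto_intros coeff) auto
    moreover have "(\<Sum>i=1..n. ((real m * real i - real (n - i)) * fps_nth F i * r m ^ i) *
            (r m ^ (n - i) * fps_nth (F ^ m) (n - i))) / real n = r m ^ n * fps_nth (F ^ m) n" for m
    proof -
      have "(\<Sum>i=1..n. ((real m * real i - real (n - i)) * fps_nth F i * r m ^ i) *
            (r m ^ (n - i) * fps_nth (F ^ m) (n - i))) =
          r m ^ n * (\<Sum>i=1..n. (real m * real i - real (n - i)) * fps_nth F i *
            fps_nth (F ^ m) (n - i))"
        unfolding sum_distrib_left
      proof (intro sum.cong refl)
        fix i assume "i \<in> {1..n}"
        then have "r m ^ n = r m ^ i * r m ^ (n - i)"
          by (simp flip: power_add)
        then show "(real m * real i - real (n - i)) * fps_nth F i * r m ^ i *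
            (r m ^ (n - i) * fps_nth (F ^ m) (n - i)) =
          r m ^ n * ((real m * real i - real (n - i)) * fps_nth F i * fps_nth (F ^ m) (n - i))"
          by (simp add: mult_ac)
      qed
      also have "\<dots> = r m ^ n * (real n * fps_nth (F ^ m) n)"
        by (simp only: fps_power_nth_rec[OF F0])
      finally show ?thesis using False by simp
    qed
    \<comment> \<open>With \<open>a = fps_nth F d\<close>, this is the recursion
      \<open>n * Q n = d * a * Q (n - d)\<close>, which encodes z G' = d a z^d G for G = exp(a
      z^d).\<close>
    moreover have "(\<Sum>i=1..n. (if i = d then real d * fps_nth F d else 0) * Q (n - i)) / real n = Q n"
    proof -
      have "(\<Sum>i=1..n. (if i = d then real d * fps_nth F d else 0) * Q (n - i)) =
          (\<Sum>i=1..n. if i = d then real d * fps_nth F d * Q (n - d) else 0)"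
        by (intro sum.cong) auto
      also have "\<dots> = (if d \<le> n then real d * fps_nth F d * Q (n - d) else 0)"
        using \<open>d > 0\<close> by auto
      also have "\<dots> = real n * Q n"
      proof (cases "d dvd n")
        case True
        then obtain k where "n = d * Suc k" using \<open>n \<noteq> 0\<close>
          by (metis dvdE mult_0_right not0_implies_Suc)
        moreover from this have "n - d = d * k" by simp
        ultimately show ?thesis using \<open>d > 0\<close> by (simp add: Q_def divide_simps) (simp add: algebra_simps)
      next
        case False
        moreover have "\<not> d dvd (n - d)" if "d \<le> n"
          using False that by (simp add: dvd_minus_self)
        ultimately show ?thesis by (simp add: Q_def)
      qed
      finally show ?thesis using False by simp
    qed
    ultimately show ?thesis by (simp add: Q_def)
  qed
qed

text \<open>With \<open>f 1 = 0\<close> the square term of the logarithm has no z^2 coefficient, so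
  only its linear term contributes.\<close>

lemma cumulant_2:
  assumes "t \<noteq> 0" "f 1 = 0"
  shows "cumulant t f 2 = - 2 * t * (f 2 / falling_fact t 2)"
  using assms
  by (simp add: cumulant_def cumulant_series_def mult.assoc fps_compose_nth fps_ln_nth
      numeral_2_eq_2 fps_mult_nth)

theorem theorem3p9:
  fixes t :: real and f :: "nat \<Rightarrow> real"
  assumes "t \<notin> \<nat>" and "f \<in> UH"
  shows "(\<forall>l::real. cumulant t f 1 = l \<longrightarrow>
            (\<forall>n. (\<lambda>m. dilation (1 / real m) (hconv_power t f m) n)
                   \<longlonglongrightarrow> binomial_series t l n))
       \<and> (cumulant t f 1 = 0 \<and> cumulant t f 2 = 1 \<longrightarrow>
            (\<forall>n. (\<lambda>m. dilation (1 / sqrt (real m)) (hconv_power t f m) n)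
                   \<longlonglongrightarrow> hermite_series t n))"
proof -
  define F where "F = Abs_fps (\<lambda>k. f k / falling_fact t k)"
  have t: "t \<noteq> 0" using assms(1) by auto
  have F0: "fps_nth F 0 = 1" using assms(2) by (simp add: F_def UH_def falling_fact_def)
  have F1: "fps_nth F 1 = - cumulant t f 1"
    unfolding cumulant_1[OF t] by (simp add: F_def falling_fact_def)
  have dil: "dilation r (hconv_power t f m) n = falling_fact t n * (r ^ n * fps_nth (F ^ m) n)"
    for r m n
    by (simp add: dilation_def hconv_power_eq_fps_power[OF assms(1)] F_def)
  have "(\<lambda>m. dilation (1 / real m) (hconv_power t f m) n) \<longlonglongrightarrow> binomial_series t (cumulant t f 1) n"
    for n
  proof -
    \<comment> \<open>The product equals 1 only from \<open>m = 1\<close> on; at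
      \<open>m = 0\<close> division by zero makes it 0.\<close>
    have "(\<lambda>m. real m * (1 / real m) ^ 1) \<longlonglongrightarrow> 1"
      by (rule tendsto_eventually) (auto intro!: eventually_sequentiallyI[of 1])
    then have "(\<lambda>m. (1 / real m) ^ n * fps_nth (F ^ m) n) \<longlonglongrightarrow> fps_nth F 1 ^ n / fact n"
      using tendsto_scaled_fps_power_nth[of F 1 "\<lambda>m. 1 / real m" n] F0 lim_1_over_n by simp
    from tendsto_mult_left[OF this, of "falling_fact t n"] show ?thesis
      by (simp add: dil F1[simplified] binomial_series_def power_minus[of "cumulant t f (Suc 0)"] mult_ac)
  qed
  moreover have "(\<lambda>m. dilation (1 / sqrt (real m)) (hconv_power t f m) n) \<longlonglongrightarrow> hermite_series t n"
    if k1: "cumulant t f 1 = 0" and k2: "cumulant t f 2 = 1" for n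
  proof -
    have f1: "f 1 = 0" using k1 t unfolding cumulant_1[OF t] by simp
    \<comment> \<open>Hence the limit series is exp(-z^2/(2t)), whose coefficient at 2k supplies the
      sign, \<open>t ^ k\<close> and the double factorial \<open>2 ^ k * fact k\<close>.\<close>
    have F2: "fps_nth F 2 = - 1 / (2 * t)"
      using k2 t unfolding cumulant_2[of t f, OF t f1] F_def by (simp add: field_simps)
    have gap: "fps_nth F i = 0" if "0 < i" "i < 2" for i
    proof -
      have "i = 1" using that by simp
      then show ?thesis using F1 k1 by simp
    qed
    have r: "(\<lambda>m. 1 / sqrt (real m)) \<longlonglongrightarrow> 0"
      using tendsto_real_sqrt[OF lim_1_over_n[where 'a = real]] by (simp add: real_sqrt_divide)
    have mr: "(\<lambda>m. real m * (1 / sqrt (real m)) ^ 2) \<longlonglongrightarrow> 1"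
      by (rule tendsto_eventually)
        (auto intro!: eventually_sequentiallyI[of 1] simp: power_divide)
    have "hermite_series t n = falling_fact t n *
        (if 2 dvd n then fps_nth F 2 ^ (n div 2) / fact (n div 2) else 0)"
      unfolding hermite_series_def F2
      by (auto simp: Let_def power_divide power_mult_distrib minus_divide_left [symmetric]
          power_minus[of "1 / (2 * t)"]) (simp add: mult_ac)
    then show ?thesis
      unfolding dil
      using tendsto_mult_left[OF tendsto_scaled_fps_power_nth[OF F0 gap zero_less_numeral r mr]]
      by simp
  qed
  ultimately show ?thesis by blast
qed

end
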